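(* Let $p(x)=x^n+a_{n-1}x^{n-1}+\cdots+a_1x+a_0$ be a monic complex polynomial of degree $n\ge 3$ with $a_0\neq 0$, and let $M=\max\{|a_k| : 1\le k\le n-1\}$. Let $\mathcal{F}$ be the Frobenius companion matrix of $p$. Suppose $A$ is of type $E_c(p^\sharp)^{-1}$ for some $c$ with $1\le c\le n-2$. Then: (a) If $|a_0|=1$ then $N(\mathcal{F})\le N(A)$. (b) If $|a_0|>1$ then $\|W\|_\infty\le\|A\|_\infty$. (c) If $|a_0|>1$ and $|a_{n-1}|=M$ then $N(\mathcal{F})\le N(A)$. (d) If $|a_0|<1$ then (i) $N(\mathcal{F})-\|A\|_\infty\le 1$, (ii) $N(\mathcal{F})\le 2\|A\|_\infty$, and (iii) $N(\mathcal{F})\le\|A\|_1$.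
   Context: For an $n\times n$ complex matrix $A=[a_{ij}]$, $\|A\|_\infty=\max_i\sum_j|a_{ij}|$, $\|A\|_1=\max_j\sum_i|a_{ij}|$, and $N(A)=\min\{\|A\|_\infty,\|A\|_1\}$. The Frobenius companion matrix $\mathcal{F}$ of $p$ is the $n\times n$ matrix with $1$ in each position $(i,i+1)$, $1\le i\le n-1$, last row $(-a_0,-a_1,\ldots,-a_{n-1})$, and all other entries $0$. The monic reversal polynomial of $p$ (with $a_0\ne 0$) is $p^\sharp(x)=\frac{x^n}{a_0}p(x^{-1})=x^n+\frac{a_1}{a_0}x^{n-1}+\cdots+\frac{a_{n-1}}{a_0}x+\frac1{a_0}$. Let $q(x)=x^n+b_{n-1}x^{n-1}+\cdots+b_0$ be monic with $b_0\neq 0$, and let $1\le c\le n-2$. A matrix is of type $E_c(q)$ if it is an $n\times n$ matrix with $1$ in each position $(i,i+1)$, $1\le i\le n-1$; with each $-b_k$ ($0\le k\le n-1$) placed in exactly one position $(i,j)$ satisfying $c+1\le i\le n$, $1\le j\le c+1$ and $i-j=n-1-k$; with all other entries $0$; and such that the only nonzero entry of its first column is $-b_0$ in position $(n,1)$. (These are unit sparse companion matrices of $q$ and are invertible.) A matrix $A$ is of type $E_c(p^\sharp)^{-1}$ if $A$ is invertible and $A^{-1}$ is of type $E_c(p^\sharp)$. $W$ is the unique matrix of type $E_1(p^\sharp)^{-1}$: it is the $n\times n$ matrix with $-a_{n-1}$ in position $(1,1)$, $-a_0$ in position $(1,n)$, $1$ in position $(2,1)$, and, for $1\le k\le n-2$,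 $a_k/a_0$ in position $(k+2,1)$ and $1$ in position $(k+2,k+1)$; all other entries are $0$. *)

theory Defs
  imports "Jordan_Normal_Form.Determinant"
begin

(* Matrices are those of the Jordan_Normal_Form entry.  Its rows and columns are numbered from 0,
   so the (i,j) entry of the mathematical text is A $$ (i - 1, j - 1) here. *)

definition norm_inf :: "complex mat \<Rightarrow> real" where
  "norm_inf A = Max ((\<lambda>i. \<Sum>j<dim_col A. cmod (A $$ (i, j))) ` {..<dim_row A})"

definition norm_one :: "complex mat \<Rightarrow> real" where
  "norm_one A = Max ((\<lambda>j. \<Sum>i<dim_row A. cmod (A $$ (i, j))) ` {..<dim_col A})"

definition norm_min :: "complex mat \<Rightarrow> real" where
  "norm_min A = min (norm_inf A) (norm_one A)"

definition frobenius_companion :: "complex poly \<Rightarrow> complex mat" where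
  "frobenius_companion p = mat (degree p) (degree p) (\<lambda>(i, j).
     if i = degree p - 1 then - coeff p j else if j = i + 1 then 1 else 0)"

(* reflect_poly p is x^n p(1/x) with n = degree p. *)
definition monic_reversal :: "complex poly \<Rightarrow> complex poly" where
  "monic_reversal p = smult (1 / coeff p 0) (reflect_poly p)"

(* pos k is the (0-based) position of the entry - coeff q k.  The constraint i - j = n - 1 - k puts
   different k on different diagonals, none of them above the main diagonal, so pos is injective and
   avoids the positions (i, i + 1). *)
definition type_E :: "nat \<Rightarrow> complex poly \<Rightarrow> complex mat \<Rightarrow> bool" where
  "type_E c q B \<longleftrightarrow> (let n = degree q in
     B \<in> carrier_mat n n \<and>
     (\<exists>pos :: nat \<Rightarrow> nat \<times> nat.
        (\<forall>k<n. case pos k of (i, j) \<Rightarrow>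
           c \<le> i \<and> i < n \<and> j \<le> c \<and> int i - int j = int n - 1 - int k) \<and>
        (\<forall>i<n. \<forall>j<n. j = i + 1 \<longrightarrow> B $$ (i, j) = 1) \<and>
        (\<forall>k<n. B $$ pos k = - coeff q k) \<and>
        (\<forall>i<n. \<forall>j<n. j \<noteq> i + 1 \<and> (i, j) \<notin> pos ` {..<n} \<longrightarrow> B $$ (i, j) = 0)) \<and>
     B $$ (n - 1, 0) = - coeff q 0 \<and>
     (\<forall>i<n - 1. B $$ (i, 0) = 0))"

definition type_E_inverse :: "nat \<Rightarrow> complex poly \<Rightarrow> complex mat \<Rightarrow> bool" where
  "type_E_inverse c q A \<longleftrightarrow> A \<in> carrier_mat (degree q) (degree q) \<and>
     (\<exists>B. inverts_mat A B \<and> inverts_mat B A \<and> type_E c q B)"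

definition W_mat :: "complex poly \<Rightarrow> complex mat" where
  "W_mat p = (let n = degree p in mat n n (\<lambda>(i, j).
     if i = 0 then (if j = 0 then - coeff p (n - 1) else if j = n - 1 then - coeff p 0 else 0)
     else if i = 1 then (if j = 0 then 1 else 0)
     else if j = 0 then coeff p (i - 1) / coeff p 0
     else if j = i - 1 then 1 else 0))"

lemma degree_monic_reversal:
  assumes "coeff p 0 \<noteq> 0"
  shows "degree (monic_reversal p) = degree p"
  using assms by (simp add: monic_reversal_def)

lemma coeff_monic_reversal:
  assumes "coeff p 0 \<noteq> 0"
  shows "coeff (monic_reversal p) k = (if k > degree p then 0 else coeff p (degree p - k) / coeff p 0)"
  by (simp add: monic_reversal_def coeff_reflect_poly)

definition E1_mat :: "complex poly \<Rightarrow> complex mat" where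
  "E1_mat q = (let n = degree q in mat n n (\<lambda>(i, j).
     if j = i + 1 then 1 else if j = 0 then (if i = n - 1 then - coeff q 0 else 0)
     else if j = 1 then - coeff q (n - i) else 0))"

lemma type_E_1_iff:
  assumes n: "degree q \<ge> 3"
  shows "type_E 1 q B \<longleftrightarrow> B = E1_mat q"
proof -
  define n where "n = degree q"
  have n3: "n \<ge> 3" using n by (simp add: n_def)
  show ?thesis
  proof
    assume B: "type_E 1 q B"
    from B have dim: "B \<in> carrier_mat n n"
      and c0: "B $$ (n - 1, 0) = - coeff q 0" and c1: "\<And>i. i < n - 1 \<Longrightarrow> B $$ (i, 0) = 0"
      by (simp_all add: type_E_def Let_def n_def)
    from B have "\<exists>pos :: nat \<Rightarrow> nat \<times> nat.
        (\<forall>k<n. case pos k of (i, j) \<Rightarrow>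
           1 \<le> i \<and> i < n \<and> j \<le> 1 \<and> int i - int j = int n - 1 - int k) \<and>
        (\<forall>i<n. \<forall>j<n. j = i + 1 \<longrightarrow> B $$ (i, j) = 1) \<and>
        (\<forall>k<n. B $$ pos k = - coeff q k) \<and>
        (\<forall>i<n. \<forall>j<n. j \<noteq> i + 1 \<and> (i, j) \<notin> pos ` {..<n} \<longrightarrow> B $$ (i, j) = 0)"
      unfolding type_E_def Let_def n_def[symmetric] by (elim conjE)
    then obtain pos :: "nat \<Rightarrow> nat \<times> nat" where
          pos': "\<forall>k<n. case pos k of (i, j) \<Rightarrow>
             1 \<le> i \<and> i < n \<and> j \<le> 1 \<and> int i - int j = int n - 1 - int k"
      and sup': "\<forall>i<n. \<forall>j<n. j = i + 1 \<longrightarrow> B $$ (i, j) = 1"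
      and ent': "\<forall>k<n. B $$ pos k = - coeff q k"
      and oth': "\<forall>i<n. \<forall>j<n. j \<noteq> i + 1 \<and> (i, j) \<notin> pos ` {..<n} \<longrightarrow> B $$ (i, j) = 0"
      by (elim exE conjE)
    note pos = pos'[rule_format] and sup = sup'[rule_format] and ent = ent'[rule_format]
    have oth: "B $$ (i, j) = 0" if "i < n" "j < n" "j \<noteq> i + 1" "(i, j) \<notin> pos ` {..<n}" for i j
      using oth' that by (intro oth'[rule_format] conjI)
    have posk: "pos k = (n - 1 - k, 0) \<or> pos k = (n - k, 1)" if "k < n" for k
    proof -
      obtain i j where ij: "pos k = (i, j)" by (cases "pos k")
      have *: "j \<le> 1" "int i - int j = int n - 1 - int k" using pos[OF that] ij by auto
      show ?thesis
      proof (cases "j = 0")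
        case True
        then have "i = n - 1 - k" using * that by linarith
        then show ?thesis using ij True by simp
      next
        case False
        then have "j = 1" "i = n - k" using * that by linarith+
        then show ?thesis using ij by simp
      qed
    qed
    have "B $$ (i, j) = E1_mat q $$ (i, j)" if ij: "i < n" "j < n" for i j
    proof -
      consider "j = i + 1" | "j = 0" | "j \<noteq> i + 1" "j = 1" | "j \<noteq> i + 1" "j \<ge> 2" by linarith
      then show ?thesis
      proof cases
        case 1
        then show ?thesis using sup ij by (auto simp: E1_mat_def Let_def n_def[symmetric])
      next
        case 2
        then show ?thesis using c0 c1[of i] ij
          by (cases "i = n - 1") (auto simp: E1_mat_def Let_def n_def[symmetric])
      next
        case 3
        then have i: "i \<ge> 1" by linarith
        have e: "E1_mat q $$ (i, j) = - coeff q (n - i)"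
          using 3 ij by (simp add: E1_mat_def Let_def n_def[symmetric])
        have k: "n - i < n" using i ij by linarith
        have "B $$ (i, 1) = - coeff q (n - i)"
        proof (cases "pos (n - i) = (i, 1)")
          case True
          then show ?thesis using ent[OF k] by simp
        next
          case False
          have "n - (n - i) = i" "n - 1 - (n - i) = i - 1" using ij i by linarith+
          then have p0: "pos (n - i) = (i - 1, 0)" using posk[OF k] False by simp
          have "B $$ (i - 1, 0) = 0" using c1[of "i - 1"] i ij by simp
          then have z: "coeff q (n - i) = 0" using ent[OF k] p0 by simp
          have "(i, 1) \<notin> pos ` {..<n}"
          proof
            assume "(i, 1) \<in> pos ` {..<n}"
            then obtain k' where k': "k' < n" "pos k' = (i, 1)" by (metis imageE lessThan_iff)
            then have "i = n - k'" using posk[OF k'(1)] by auto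
            then have "k' = n - i" using k' by linarith
            then show False using k' False by simp
          qed
          then have "B $$ (i, 1) = 0" using oth[of i 1] 3 ij by simp
          then show ?thesis using z by simp
        qed
        then show ?thesis using e 3 by simp
      next
        case 4
        have "(i, j) \<notin> pos ` {..<n}"
        proof
          assume "(i, j) \<in> pos ` {..<n}"
          then obtain k' where k': "k' < n" "pos k' = (i, j)" by (metis imageE lessThan_iff)
          then show False using posk[OF k'(1)] 4 by auto
        qed
        then show ?thesis using oth[of i j] ij 4
          by (simp add: E1_mat_def Let_def n_def[symmetric])
      qed
    qed
    then show "B = E1_mat q"
      using dim by (intro eq_matI) (auto simp: E1_mat_def Let_def n_def[symmetric])
  next
    assume B: "B = E1_mat q"
    define pos where "pos = (\<lambda>k::nat. if k = 0 then (n - 1, 0::nat) else (n - k, 1))"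
    have "(i, j) \<in> pos ` {..<n}" if "i < n" "j < n" "j \<noteq> i + 1" "E1_mat q $$ (i, j) \<noteq> 0" for i j
    proof -
      from that have "j = 0 \<and> i = n - 1 \<or> j = 1 \<and> i \<noteq> 0"
        by (auto simp: E1_mat_def Let_def n_def[symmetric] split: if_splits)
      then show ?thesis
      proof
        assume "j = 0 \<and> i = n - 1"
        then show ?thesis using n3 by (intro image_eqI[of _ _ 0]) (auto simp: pos_def)
      next
        assume "j = 1 \<and> i \<noteq> 0"
        then show ?thesis using that by (intro image_eqI[of _ _ "n - i"]) (auto simp: pos_def)
      qed
    qed
    then have "\<forall>i<n. \<forall>j<n. j \<noteq> i + 1 \<and> (i, j) \<notin> pos ` {..<n} \<longrightarrow> B $$ (i, j) = 0"
      unfolding B by blast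
    moreover have "\<forall>k<n. case pos k of (i, j) \<Rightarrow>
           1 \<le> i \<and> i < n \<and> j \<le> 1 \<and> int i - int j = int n - 1 - int k"
      using n3 by (auto simp: pos_def of_nat_diff)
    moreover have "\<forall>k<n. B $$ pos k = - coeff q k"
      using n3 unfolding B by (auto simp: pos_def E1_mat_def Let_def n_def[symmetric])
    moreover have "\<forall>i<n. \<forall>j<n. j = i + 1 \<longrightarrow> B $$ (i, j) = 1"
      unfolding B by (auto simp: E1_mat_def Let_def n_def[symmetric])
    moreover have "B $$ (n - 1, 0) = - coeff q 0" "\<forall>i<n - 1. B $$ (i, 0) = 0"
      "B \<in> carrier_mat n n"
      using n3 unfolding B by (auto simp: E1_mat_def Let_def n_def[symmetric])
    ultimately show "type_E 1 q B"
      unfolding type_E_def Let_def n_def[symmetric] by (intro conjI exI[of _ pos])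
  qed
qed

lemma E1_times_W:
  assumes n: "degree p \<ge> 3" and a0: "coeff p 0 \<noteq> 0" and monic: "lead_coeff p = 1"
  shows "E1_mat (monic_reversal p) * W_mat p = 1\<^sub>m (degree p)"
proof (rule eq_matI)
  define n where "n = degree p"
  note nd = n_def[symmetric]
  have n3: "n \<ge> 3" using n by (simp add: n_def)
  have lc: "coeff p n = 1" using monic by (simp add: n_def)
  fix i j assume "i < dim_row (1\<^sub>m (degree p) :: complex mat)" "j < dim_col (1\<^sub>m (degree p) :: complex mat)"
  then have ij: "i < n" "j < n" by (simp_all add: n_def)
  define E where "E = E1_mat (monic_reversal p)"
  define u where "u = (if i = n - 1 then - (1 / coeff p 0) else 0)"
  define v where "v = (if i = 0 then 0 else - (coeff p i / coeff p 0))"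
  have E_entry: "E $$ (i, k) = (if k = i + 1 then 1 else 0) + (if k = 0 then u else 0)
      + (if k = 1 then v else 0)" if k: "k < n" for k
  proof -
    have e: "E $$ (i, k) = (if k = i + 1 then 1 else if k = 0 then (if i = n - 1 then - (1 / coeff p 0) else 0)
       else if k = 1 then - (coeff p (n - (n - i)) / coeff p 0) else 0)"
      using ij k lc by (auto simp: E_def E1_mat_def Let_def degree_monic_reversal[OF a0] coeff_monic_reversal[OF a0] nd)
    have ni: "n - (n - i) = i" using ij by linarith
    consider "k = 0" | "k = 1" | "k \<ge> 2" by linarith
    then show ?thesis
    proof cases
      case 1 then show ?thesis unfolding e ni u_def v_def by simp
    next
      case 2 then show ?thesis unfolding e ni u_def v_def by simp
    next
      case 3 then show ?thesis unfolding e ni u_def v_def by simp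
    qed
  qed
  have W0: "W_mat p $$ (0, j) = (if j = 0 then - coeff p (n - 1) else if j = n - 1 then - coeff p 0 else 0)"
    and W1: "W_mat p $$ (1, j) = (if j = 0 then 1 else 0)"
    and Wi: "i + 1 < n \<Longrightarrow> i \<noteq> 0 \<Longrightarrow> W_mat p $$ (i + 1, j) =
       (if j = 0 then coeff p i / coeff p 0 else if j = i then 1 else 0)"
    using ij n3 by (simp_all add: W_mat_def Let_def nd)
  have "(E * W_mat p) $$ (i, j) = (\<Sum>k<n. E $$ (i, k) * W_mat p $$ (k, j))"
    using ij by (simp add: E_def E1_mat_def W_mat_def Let_def degree_monic_reversal[OF a0] nd
        scalar_prod_def atLeast0LessThan)
  also have "\<dots> = (\<Sum>k<n. (if k = i + 1 then W_mat p $$ (k, j) else 0)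
      + (if k = 0 then u * W_mat p $$ (k, j) else 0) + (if k = 1 then v * W_mat p $$ (k, j) else 0))"
    by (intro sum.cong refl) (simp add: E_entry distrib_right)
  also have "\<dots> = (if i + 1 < n then W_mat p $$ (i + 1, j) else 0)
      + u * W_mat p $$ (0, j) + v * W_mat p $$ (1, j)"
    using n3 by (simp add: sum.distrib)
  also have "\<dots> = (if i = j then 1 else 0)"
  proof -
    consider "i = 0" | "0 < i" "i + 1 < n" | "i = n - 1" "i \<noteq> 0" using ij by linarith
    then show ?thesis
    proof cases
      case 1
      then have "u = 0" "v = 0" using n3 by (simp_all add: u_def v_def)
      then show ?thesis using 1 n3 W1 by simp
    next
      case 2
      then have "u = 0" "v = - (coeff p i / coeff p 0)" by (simp_all add: u_def v_def)
      then show ?thesis using 2 W1 Wi by simp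
    next
      case 3
      then have "u = - (1 / coeff p 0)" "v = - (coeff p (n - 1) / coeff p 0)" "\<not> i + 1 < n"
        by (simp_all add: u_def v_def)
      then show ?thesis using 3 a0 n3 W1 by (simp add: W0)
    qed
  qed
  finally show "(E1_mat (monic_reversal p) * W_mat p) $$ (i, j) = 1\<^sub>m (degree p) $$ (i, j)"
    using ij by (simp add: nd E_def)
qed (simp_all add: E1_mat_def W_mat_def Let_def degree_monic_reversal a0)

lemma type_E_inverse_1_iff_W:
  assumes n: "degree p \<ge> 3" and a0: "coeff p 0 \<noteq> 0" and monic: "lead_coeff p = 1"
  shows "type_E_inverse 1 (monic_reversal p) A \<longleftrightarrow> A = W_mat p"
proof -
  define n where "n = degree p"
  define E where "E = E1_mat (monic_reversal p)"
  have E: "E \<in> carrier_mat n n" and W: "W_mat p \<in> carrier_mat n n"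
    by (simp_all add: E_def E1_mat_def W_mat_def Let_def degree_monic_reversal a0 n_def)
  have EW: "E * W_mat p = 1\<^sub>m n"
    using E1_times_W[OF assms] by (simp add: E_def n_def)
  have WE: "W_mat p * E = 1\<^sub>m n"
    by (rule mat_mult_left_right_inverse[OF E W EW])
  have t: "type_E 1 (monic_reversal p) B \<longleftrightarrow> B = E" for B
    using n type_E_1_iff[of "monic_reversal p" B] by (simp add: degree_monic_reversal a0 E_def)
  have "A = W_mat p" if A: "A \<in> carrier_mat n n" and AE: "A * E = 1\<^sub>m n"
  proof -
    have "A = A * (E * W_mat p)" using A EW by simp
    also have "\<dots> = (A * E) * W_mat p" using A E W by (simp add: assoc_mult_mat)
    also have "\<dots> = W_mat p" using AE W by simp
    finally show ?thesis .
  qed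
  then show ?thesis
    unfolding type_E_inverse_def t inverts_mat_def
    using E W EW WE by (auto simp: degree_monic_reversal a0 n_def)
qed

end

theory Submission
  imports Defs
begin

text \<open>The first \<open>c\<close> rows of a matrix \<open>B\<close> of type \<open>E_c(p\<^sup>\<sharp>)\<close> are unit vectors, so \<open>B x = y\<close> is solved
  explicitly. Hence every nonzero \<open>a\<^sub>m\<close> with \<open>1 \<le> m \<le> n - 1\<close> reappears in \<open>B\<inverse>\<close>, either as \<open>-a\<^sub>m\<close> in the
  first row, which also contains \<open>-a\<^sub>0\<close>, or as \<open>a\<^sub>m / a\<^sub>0\<close> in a row that also contains a \<open>1\<close>; in both
  cases its column also contains a \<open>1\<close>. In particular the first row always contains \<open>-a\<^bsub>n-1\<^esub>\<close>. All
  claims follow by comparing these pairs of entries with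
  \<open>\<parallel>F\<parallel>\<^sub>1 = max |a\<^sub>0| (1 + M)\<close>.\<close>

section \<open>Bounds for the two norms\<close>

lemma norm_inf_ge_two_entries:
  assumes "i < dim_row A" "j < dim_col A" "k < dim_col A" "j \<noteq> k"
  shows "cmod (A $$ (i, j)) + cmod (A $$ (i, k)) \<le> norm_inf A"
proof -
  have "cmod (A $$ (i, j)) + cmod (A $$ (i, k)) = (\<Sum>l\<in>{j, k}. cmod (A $$ (i, l)))"
    using assms by simp
  also have "\<dots> \<le> (\<Sum>l<dim_col A. cmod (A $$ (i, l)))"
    using assms by (intro sum_mono2) auto
  also have "\<dots> \<le> norm_inf A"
    unfolding norm_inf_def using assms by (intro Max_ge) auto
  finally show ?thesis .
qed

lemma norm_one_ge_entry:
  assumes "i < dim_row A" "j < dim_col A"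
  shows "cmod (A $$ (i, j)) \<le> norm_one A"
proof -
  have "cmod (A $$ (i, j)) \<le> (\<Sum>l<dim_row A. cmod (A $$ (l, j)))"
    using assms by (intro member_le_sum) auto
  also have "\<dots> \<le> norm_one A"
    unfolding norm_one_def using assms by (intro Max_ge) auto
  finally show ?thesis .
qed

lemma norm_one_ge_two_entries:
  assumes "i < dim_row A" "k < dim_row A" "j < dim_col A" "i \<noteq> k"
  shows "cmod (A $$ (i, j)) + cmod (A $$ (k, j)) \<le> norm_one A"
proof -
  have "cmod (A $$ (i, j)) + cmod (A $$ (k, j)) = (\<Sum>l\<in>{i, k}. cmod (A $$ (l, j)))"
    using assms by simp
  also have "\<dots> \<le> (\<Sum>l<dim_row A. cmod (A $$ (l, j)))"
    using assms by (intro sum_mono2) auto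
  also have "\<dots> \<le> norm_one A"
    unfolding norm_one_def using assms by (intro Max_ge) auto
  finally show ?thesis .
qed

text \<open>Column 0 contributes only \<open>- coeff p 0\<close>; any other column \<open>j\<close>
  holds \<open>- coeff p j\<close> and one superdiagonal 1. As \<open>norm_min\<close> is at most
  \<open>norm_one\<close>, this bound suffices for every claim about the companion matrix.\<close>

lemma norm_one_frobenius_companion_le:
  assumes "degree p = n" "0 < n" "cmod (coeff p 0) \<le> x"
    and "\<And>m. 1 \<le> m \<Longrightarrow> m < n \<Longrightarrow> 1 + cmod (coeff p m) \<le> x"
  shows "norm_one (frobenius_companion p) \<le> x"
proof -
  have "(\<Sum>i<n. cmod (frobenius_companion p $$ (i, j))) \<le> x" if j: "j < n" for j
  proof -
    have "(\<Sum>i<n. cmod (frobenius_companion p $$ (i, j))) =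
        (\<Sum>i<n. (if i = n - 1 then cmod (coeff p j) else 0) + (if i = j - 1 \<and> 1 \<le> j then 1 else 0))"
      using assms j by (intro sum.cong refl) (auto simp: frobenius_companion_def)
    also have "\<dots> = cmod (coeff p j) + (if 1 \<le> j then 1 else 0)"
      using j by (cases "1 \<le> j") (simp_all add: sum.distrib)
    also have "\<dots> \<le> x"
      using assms(3) assms(4)[of j] j by (cases "j = 0") auto
    finally show ?thesis .
  qed
  then show ?thesis
    unfolding norm_one_def using assms by (subst Max_le_iff) (auto simp: frobenius_companion_def)
qed

lemma norm_inf_W_mat_le:
  assumes deg: "degree p = n" and n: "2 \<le> n" and x: "1 \<le> x"
    and first: "cmod (coeff p (n - 1)) + cmod (coeff p 0) \<le> x"
    and later: "\<And>m. 1 \<le> m \<Longrightarrow> m < n - 1 \<Longrightarrow> cmod (coeff p m / coeff p 0) + 1 \<le> x"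
  shows "norm_inf (W_mat p) \<le> x"
proof -
  have "(\<Sum>j<n. cmod (W_mat p $$ (i, j))) \<le> x" if i: "i < n" for i
  proof -
    consider "i = 0" | "i = 1" | "2 \<le> i" by linarith
    then show ?thesis
    proof cases
      case 1
      have "(\<Sum>j<n. cmod (W_mat p $$ (i, j))) =
          (\<Sum>j<n. (if j = 0 then cmod (coeff p (n - 1)) else 0) + (if j = n - 1 then cmod (coeff p 0) else 0))"
        using 1 deg n by (intro sum.cong refl) (auto simp: W_mat_def Let_def)
      also have "\<dots> = cmod (coeff p (n - 1)) + cmod (coeff p 0)"
        using n by (simp add: sum.distrib)
      finally show ?thesis using first by simp
    next
      case 2
      have "(\<Sum>j<n. cmod (W_mat p $$ (i, j))) = (\<Sum>j<n. (if j = 0 then 1 else 0))"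
        using 2 deg n by (intro sum.cong refl) (auto simp: W_mat_def Let_def)
      also have "\<dots> = 1" using n by simp
      finally show ?thesis using x by simp
    next
      case 3
      have "(\<Sum>j<n. cmod (W_mat p $$ (i, j))) =
          (\<Sum>j<n. (if j = 0 then cmod (coeff p (i - 1) / coeff p 0) else 0) + (if j = i - 1 then 1 else 0))"
        using 3 i deg n by (intro sum.cong refl) (auto simp: W_mat_def Let_def)
      also have "\<dots> = cmod (coeff p (i - 1) / coeff p 0) + 1"
        using 3 i by (simp add: sum.distrib less_imp_diff_less)
      also have "\<dots> \<le> x" using 3 i by (intro later) linarith+
      finally show ?thesis .
    qed
  qed
  then show ?thesis
    unfolding norm_inf_def using deg n by (subst Max_le_iff) (auto simp: W_mat_def Let_def lessThan_empty_iff)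
qed

section \<open>Solving for the entries of the inverse\<close>

text \<open>These facts hold however \<open>pos\<close> places the coefficients. The first column
  vanishes above its last entry, so a nonzero \<open>coeff q k\<close> with \<open>1 \<le> k\<close>
  must sit in one of the columns 1 to \<open>c\<close>.\<close>

lemma type_E_entries:
  assumes B: "type_E c q B" and deg: "degree q = n" and n: "0 < n" and c: "1 \<le> c" "c \<le> n - 2"
  shows "\<And>i j. i < n \<Longrightarrow> j < n \<Longrightarrow> i < c \<or> c < j \<or> (j = 0 \<and> i < n - 1) \<Longrightarrow>
          B $$ (i, j) = (if j = i + 1 then 1 else 0)"
    and "B $$ (n - 1, 0) = - coeff q 0"
    and "B $$ (n - 1, 1) = - coeff q 1"
    and "\<And>k. 1 \<le> k \<Longrightarrow> k < n \<Longrightarrow> coeff q k \<noteq> 0 \<Longrightarrow>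
          \<exists>i j. c \<le> i \<and> i < n \<and> 1 \<le> j \<and> j \<le> c \<and> B $$ (i, j) = - coeff q k"
proof -
  from B obtain pos where
      pos': "\<forall>k<n. case pos k of (i, j) \<Rightarrow>
         c \<le> i \<and> i < n \<and> j \<le> c \<and> int i - int j = int n - 1 - int k"
    and sup: "\<forall>i<n. \<forall>j<n. j = i + 1 \<longrightarrow> B $$ (i, j) = 1"
    and ent: "\<forall>k<n. B $$ pos k = - coeff q k"
    and oth: "\<forall>i<n. \<forall>j<n. j \<noteq> i + 1 \<and> (i, j) \<notin> pos ` {..<n} \<longrightarrow> B $$ (i, j) = 0"
    and c0: "B $$ (n - 1, 0) = - coeff q 0" and c1: "\<forall>i<n - 1. B $$ (i, 0) = 0"
    unfolding type_E_def Let_def deg by blast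
  have pos: "c \<le> i \<and> i < n \<and> j \<le> c \<and> int i - int j = int n - 1 - int k"
    if "k < n" "pos k = (i, j)" for k i j
    using pos' that by fastforce
  show "B $$ (i, j) = (if j = i + 1 then 1 else 0)"
    if "i < n" "j < n" "i < c \<or> c < j \<or> (j = 0 \<and> i < n - 1)" for i j
  proof (cases "j = i + 1")
    case True
    then show ?thesis using sup that by auto
  next
    case False
    have "B $$ (i, j) = 0"
    proof (cases "(i, j) \<in> pos ` {..<n}")
      case True
      then obtain k where "k < n" "pos k = (i, j)" by (metis imageE lessThan_iff)
      then have "c \<le> i" "j \<le> c" using pos by auto
      then show ?thesis using that c1 by auto
    qed (use oth that False in blast)
    then show ?thesis using False by simp
  qed
  show "B $$ (n - 1, 0) = - coeff q 0" by (rule c0)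
  show nz: "\<exists>i j. c \<le> i \<and> i < n \<and> 1 \<le> j \<and> j \<le> c \<and> B $$ (i, j) = - coeff q k"
    if k: "1 \<le> k" "k < n" "coeff q k \<noteq> 0" for k
  proof -
    obtain i j where ij: "pos k = (i, j)" by (cases "pos k")
    note * = pos[OF k(2) ij]
    have e: "B $$ (i, j) = - coeff q k" using ent k ij by metis
    have "j \<noteq> 0"
    proof
      assume j: "j = 0"
      \<comment> \<open>On the diagonal of \<open>k\<close>, column 0 is met in row
        \<open>n - 1 - k\<close>, which is above the last row as \<open>1 \<le> k\<close>.\<close>
      then have "i < n - 1" using * k by linarith
      then show False using c1 e k j by simp
    qed
    then show ?thesis using * e by (intro exI[of _ i] exI[of _ j]) auto
  qed
  show "B $$ (n - 1, 1) = - coeff q 1"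
  proof (cases "(n - 1, 1) \<in> pos ` {..<n}")
    case True
    then obtain k where k: "k < n" "pos k = (n - 1, 1)" by (metis imageE lessThan_iff)
    then have "k = 1" using pos[of k "n - 1" 1] n by linarith
    then show ?thesis using ent k by metis
  next
    case False
    \<comment> \<open>The only other position on this diagonal is \<open>(n - 2, 0)\<close>, where
      \<open>B\<close> vanishes. So \<open>coeff q 1 = 0\<close>, which agrees with the empty
      position \<open>(n - 1, 1)\<close>.\<close>
    have one: "1 < n" using c by linarith
    obtain i j where ij: "pos 1 = (i, j)" by (cases "pos 1")
    note * = pos[OF one ij]
    have "(i, j) \<noteq> (n - 1, 1)" using False ij one by (metis imageI lessThan_iff)
    then have "j = 0" "i < n - 1" using * by auto
    then have "coeff q 1 = 0" using ent ij one c1 by (metis neg_equal_0_iff_equal)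
    moreover have "B $$ (n - 1, 1) = 0" using oth False c by auto
    ultimately show ?thesis by simp
  qed
qed

text \<open>Read \<open>B * A = 1\<close> row by row. Rows \<open>i < c\<close> of \<open>B\<close>
  are unit vectors and give rows 1 to \<open>c\<close> of \<open>A\<close>. After substitution, a
  middle row of \<open>B\<close> leaves only \<open>A $$ (i + 1, l)\<close> unknown, and the last
  row only \<open>A $$ (0, l)\<close>.\<close>

lemma type_E_inverse_entries:
  assumes B: "type_E c q B" and A: "A \<in> carrier_mat n n" and BA: "inverts_mat B A"
    and deg: "degree q = n" and n: "0 < n" and c: "1 \<le> c" "c \<le> n - 2"
    and i: "i < n" and l: "l < n"
  shows "i + 1 < n \<Longrightarrow> A $$ (i + 1, l) =
           (if i = l then 1 else 0) - (if c \<le> i \<and> l < c then B $$ (i, l + 1) else 0)"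
    and "coeff q 0 * A $$ (0, l) = (if l < c then B $$ (n - 1, l + 1) else 0) - (if l = n - 1 then 1 else 0)"
proof -
  have Bd: "B \<in> carrier_mat n n" using B deg by (simp add: type_E_def Let_def)
  note E = type_E_entries[OF B deg n c]
  have prod: "(\<Sum>k<n. B $$ (i, k) * A $$ (k, l)) = (if i = l then 1 else 0)" if i: "i < n" for i
  proof -
    have "(B * A) $$ (i, l) = (\<Sum>k<n. B $$ (i, k) * A $$ (k, l))"
      using A Bd i l by (simp add: scalar_prod_def atLeast0LessThan)
    then show ?thesis using BA Bd i l by (simp add: inverts_mat_def)
  qed
  have upper: "A $$ (i + 1, l) = (if i = l then 1 else 0)" if ic: "i < c" for i
  proof -
    have "(\<Sum>k<n. B $$ (i, k) * A $$ (k, l)) = (\<Sum>k<n. if k = i + 1 then A $$ (k, l) else 0)"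
      using ic c by (intro sum.cong refl) (auto simp: E(1))
    also have "\<dots> = A $$ (i + 1, l)" using ic c by simp
    finally show ?thesis using prod[of i] ic c by simp
  qed
  \<comment> \<open>Row \<open>k\<close> of \<open>A\<close> is row \<open>k - 1\<close> of the
    identity, so only \<open>k = l + 1\<close> survives; it lies in this range exactly when
    \<open>l < c\<close>.\<close>
  have mid: "B $$ (i, k) * A $$ (k, l) = (if k = l + 1 then (if l < c then B $$ (i, l + 1) else 0) else 0)"
    if "1 \<le> k" "k \<le> c" for i k
    using upper[of "k - 1"] that by auto
  show "coeff q 0 * A $$ (0, l) = (if l < c then B $$ (n - 1, l + 1) else 0) - (if l = n - 1 then 1 else 0)"
  proof -
    \<comment> \<open>The last row has no superdiagonal 1, so it is zero beyond column
      \<open>c\<close>.\<close>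
    have "(\<Sum>k<n. B $$ (n - 1, k) * A $$ (k, l)) =
      (\<Sum>k<n. (if k = 0 then - coeff q 0 * A $$ (0, l) else 0)
         + (if k = l + 1 then (if l < c then B $$ (n - 1, l + 1) else 0) else 0))"
    proof (intro sum.cong refl)
      fix k assume k: "k \<in> {..<n}"
      consider "k = 0" | "1 \<le> k" "k \<le> c" | "c < k" by linarith
      then show "B $$ (n - 1, k) * A $$ (k, l) = (if k = 0 then - coeff q 0 * A $$ (0, l) else 0)
         + (if k = l + 1 then (if l < c then B $$ (n - 1, l + 1) else 0) else 0)"
      proof cases
        case 1 then show ?thesis using E(2) by simp
      next
        case 2 then show ?thesis using mid[OF 2] by simp
      next
        case 3 then show ?thesis using k n E(1)[of "n - 1" k] by auto
      qed
    qed
    also have "\<dots> = - coeff q 0 * A $$ (0, l) + (if l < c then B $$ (n - 1, l + 1) else 0)"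
      using n c by (auto simp: sum.distrib)
    finally show ?thesis using prod[of "n - 1"] n by (auto simp: algebra_simps)
  qed
  show "A $$ (i + 1, l) = (if i = l then 1 else 0) - (if c \<le> i \<and> l < c then B $$ (i, l + 1) else 0)"
    if i1: "i + 1 < n"
  proof (cases "i < c")
    case True
    then show ?thesis using upper by simp
  next
    case False
    \<comment> \<open>Now \<open>c \<le> i < n - 1\<close>: the entry in column 0 is zero, and
      beyond column \<open>c\<close> only the superdiagonal 1 remains.\<close>
    have "(\<Sum>k<n. B $$ (i, k) * A $$ (k, l)) =
      (\<Sum>k<n. (if k = i + 1 then A $$ (k, l) else 0)
         + (if k = l + 1 then (if l < c then B $$ (i, l + 1) else 0) else 0))"
    proof (intro sum.cong refl)
      fix k assume k: "k \<in> {..<n}"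
      consider "k = 0" | "1 \<le> k" "k \<le> c" | "c < k" by linarith
      then show "B $$ (i, k) * A $$ (k, l) = (if k = i + 1 then A $$ (k, l) else 0)
         + (if k = l + 1 then (if l < c then B $$ (i, l + 1) else 0) else 0)"
      proof cases
        case 1 then show ?thesis using i1 E(1)[of i 0] by (simp add: less_diff_conv)
      next
        case 2 then show ?thesis using mid[OF 2] False by simp
      next
        case 3 then show ?thesis using k i1 E(1)[of i k] by auto
      qed
    qed
    also have "\<dots> = A $$ (i + 1, l) + (if l < c then B $$ (i, l + 1) else 0)"
      using i1 c by (auto simp: sum.distrib)
    finally show ?thesis using prod[of i] i1 False by (auto simp: algebra_simps)
  qed
qed

text \<open>An entry of \<open>B\<close> in the last row moves to row 0 of \<open>A\<close>, scaled
  by \<open>coeff p 0\<close>; from a higher row it moves one row down and one column left with its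
  sign changed. The bound \<open>l + 1 < n\<close> separates it from \<open>- coeff p 0\<close> in
  row 0, and \<open>l < i\<close> separates it from the 1s at \<open>(i + 1, i)\<close> and
  \<open>(l + 1, l)\<close>.\<close>

lemma type_E_inverse_monic_reversal_entries:
  assumes A: "type_E_inverse c (monic_reversal p) A"
    and monic: "lead_coeff p = 1" and deg: "degree p = n" and a0: "coeff p 0 \<noteq> 0"
    and n: "0 < n" and c: "1 \<le> c" "c \<le> n - 2"
  shows "A \<in> carrier_mat n n"
    and "A $$ (0, n - 1) = - coeff p 0"
    and "A $$ (0, 0) = - coeff p (n - 1)"
    and "\<And>i. i + 1 < n \<Longrightarrow> A $$ (i + 1, i) = 1"
    and "\<And>m. 1 \<le> m \<Longrightarrow> m < n \<Longrightarrow> coeff p m \<noteq> 0 \<Longrightarrow> \<exists>l. l + 1 < n \<and>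
           (A $$ (0, l) = - coeff p m \<or>
            (\<exists>i. l < i \<and> i + 1 < n \<and> A $$ (i + 1, l) = coeff p m / coeff p 0))"
proof -
  define q where "q = monic_reversal p"
  have dq: "degree q = n" using deg a0 by (simp add: q_def degree_monic_reversal)
  have q0: "coeff q 0 = 1 / coeff p 0"
    using monic a0 deg by (simp add: q_def coeff_monic_reversal)
  have qk: "coeff q k = coeff p (n - k) / coeff p 0" if "k < n" for k
    using that a0 deg by (simp add: q_def coeff_monic_reversal)
  from A obtain B where Ad: "A \<in> carrier_mat n n" and BA: "inverts_mat B A" and B: "type_E c q B"
    unfolding type_E_inverse_def q_def[symmetric] dq by blast
  note E = type_E_entries[OF B dq n c]
  note I = type_E_inverse_entries[OF B Ad BA dq n c]
  show "A \<in> carrier_mat n n" by (rule Ad)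
  have row0: "A $$ (0, l) = coeff p 0 * ((if l < c then B $$ (n - 1, l + 1) else 0) - (if l = n - 1 then 1 else 0))"
    if "l < n" for l
    using I(2)[of 0 l] that n a0 by (simp add: q0 field_simps)
  \<comment> \<open>Since \<open>c \<le> n - 2\<close>, the column \<open>n - 1\<close> is not below
    \<open>c\<close>, and the \<open>B\<close> term drops out.\<close>
  show "A $$ (0, n - 1) = - coeff p 0" using row0[of "n - 1"] n c by auto
  show "A $$ (0, 0) = - coeff p (n - 1)"
    using row0[of 0] n c a0 qk[of 1] E(3) by auto
  show "A $$ (i + 1, i) = 1" if "i + 1 < n" for i
    using I(1)[of i i] that by auto
  show "\<exists>l. l + 1 < n \<and> (A $$ (0, l) = - coeff p m \<or>
            (\<exists>i. l < i \<and> i + 1 < n \<and> A $$ (i + 1, l) = coeff p m / coeff p 0))"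
    if m: "1 \<le> m" "m < n" "coeff p m \<noteq> 0" for m
  proof -
    have qm: "coeff q (n - m) = coeff p m / coeff p 0" using qk[of "n - m"] m by simp
    then obtain i j where ij: "c \<le> i" "i < n" "1 \<le> j" "j \<le> c" "B $$ (i, j) = - (coeff p m / coeff p 0)"
      using E(4)[of "n - m"] m a0 by fastforce
    show ?thesis
    proof (cases "i = n - 1")
      case True
      then have "A $$ (0, j - 1) = - coeff p m" using row0[of "j - 1"] ij c a0 by auto
      then show ?thesis using ij c by (intro exI[of _ "j - 1"]) auto
    next
      case False
      then have "A $$ (i + 1, j - 1) = coeff p m / coeff p 0" using I(1)[of i "j - 1"] ij by auto
      then show ?thesis using ij False c
        by (intro exI[of _ "j - 1"] conjI disjI2 exI[of _ i]) auto
    qed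
  qed
qed

section \<open>Comparison of the norms\<close>

theorem theorem7p1:
  fixes p :: "complex poly" and n c :: nat and A :: "complex mat" and M :: real
  assumes monic: "lead_coeff p = 1"
    and deg: "degree p = n" and n3: "n \<ge> 3"
    and a0: "coeff p 0 \<noteq> 0"
    and M: "M = Max ((\<lambda>k. cmod (coeff p k)) ` {1..n - 1})"
    and c: "1 \<le> c" "c \<le> n - 2"
    and A: "type_E_inverse c (monic_reversal p) A"
  shows "(cmod (coeff p 0) = 1 \<longrightarrow> norm_min (frobenius_companion p) \<le> norm_min A) \<and>
         (cmod (coeff p 0) > 1 \<longrightarrow> norm_inf (W_mat p) \<le> norm_inf A) \<and>
         (cmod (coeff p 0) > 1 \<and> cmod (coeff p (n - 1)) = M \<longrightarrow>
           norm_min (frobenius_companion p) \<le> norm_min A) \<and>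
         (cmod (coeff p 0) < 1 \<longrightarrow>
           norm_min (frobenius_companion p) - norm_inf A \<le> 1 \<and>
           norm_min (frobenius_companion p) \<le> 2 * norm_inf A \<and>
           norm_min (frobenius_companion p) \<le> norm_one A)"
proof -
  have n0: "0 < n" and dp: "degree (monic_reversal p) = n"
    using n3 deg a0 by (simp_all add: degree_monic_reversal)
  note S = type_E_inverse_monic_reversal_entries[OF A monic deg a0 n0 c]
  have dims: "dim_row A = n" "dim_col A = n" using S(1) by auto
  let ?a = "\<lambda>k. cmod (coeff p k)"
  have a0pos: "0 < ?a 0" using a0 by simp
  have inf_first: "?a (n - 1) + ?a 0 \<le> norm_inf A"
    using norm_inf_ge_two_entries[of 0 A 0 "n - 1"] n3 S(2,3) by (simp add: dims)
  have one_first: "1 + ?a (n - 1) \<le> norm_one A"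
    using norm_one_ge_two_entries[of 1 A 0 0] n3 S(3) S(4)[of 0] by (simp add: dims)
  have one_a0: "?a 0 \<le> norm_one A"
    using norm_one_ge_entry[of 0 A "n - 1"] n3 S(2) by (simp add: dims)
  have inf_1: "1 \<le> norm_inf A"
    using norm_inf_ge_two_entries[of 1 A 0 1] n3 S(4)[of 0] norm_ge_zero[of "A $$ (1, 1)"]
    by (simp add: dims del: norm_ge_zero)
  \<comment> \<open>The alternatives are the two places of \<open>coeff p m\<close>: beside
    \<open>- coeff p 0\<close> in row 0, or beside a 1 in a later row.\<close>
  have inf_m: "?a 0 + ?a m \<le> norm_inf A \<or> 1 + ?a m / ?a 0 \<le> norm_inf A" if m: "1 \<le> m" "m < n" for m
  proof (cases "coeff p m = 0")
    case True
    then show ?thesis using inf_1 by simp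
  next
    case False
    from S(5)[OF m this] obtain l where l: "l + 1 < n"
      and "A $$ (0, l) = - coeff p m \<or>
           (\<exists>i. l < i \<and> i + 1 < n \<and> A $$ (i + 1, l) = coeff p m / coeff p 0)" by blast
    then show ?thesis
    proof (elim disjE exE conjE)
      assume "A $$ (0, l) = - coeff p m"
      then show ?thesis
        using norm_inf_ge_two_entries[of 0 A "n - 1" l] l S(2) by (simp add: dims)
    next
      fix i assume "l < i" "i + 1 < n" "A $$ (i + 1, l) = coeff p m / coeff p 0"
      then show ?thesis
        using norm_inf_ge_two_entries[of "i + 1" A i l] S(4)[of i] by (simp add: dims norm_divide)
    qed
  qed
  have one_m: "1 + ?a m \<le> norm_one A \<or> 1 + ?a m / ?a 0 \<le> norm_one A" if m: "1 \<le> m" "m < n" for m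
  proof (cases "coeff p m = 0")
    case True
    then show ?thesis using one_first norm_ge_zero[of "coeff p (n - 1)"] by (simp del: norm_ge_zero)
  next
    case False
    from S(5)[OF m this] obtain l where l: "l + 1 < n"
      and "A $$ (0, l) = - coeff p m \<or>
           (\<exists>i. l < i \<and> i + 1 < n \<and> A $$ (i + 1, l) = coeff p m / coeff p 0)" by blast
    then show ?thesis
    proof (elim disjE exE conjE)
      assume "A $$ (0, l) = - coeff p m"
      then show ?thesis
        using norm_one_ge_two_entries[of "l + 1" A 0 l] l S(4)[of l] by (simp add: dims)
    next
      fix i assume "l < i" "i + 1 < n" "A $$ (i + 1, l) = coeff p m / coeff p 0"
      then show ?thesis
        using norm_one_ge_two_entries[of "l + 1" A "i + 1" l] S(4)[of l] by (simp add: dims norm_divide)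
    qed
  qed
  have F: "norm_min (frobenius_companion p) \<le> x"
    if "?a 0 \<le> x" "\<And>m. 1 \<le> m \<Longrightarrow> m < n \<Longrightarrow> 1 + ?a m \<le> x" for x
    using norm_one_frobenius_companion_le[OF deg n0 that] by (simp add: norm_min_def)
  have small: "?a m \<le> ?a m / ?a 0" if "?a 0 \<le> 1" for m
    using that a0pos by (simp add: pos_le_divide_eq mult_left_le)
  have large: "?a m / ?a 0 \<le> ?a m" if "?a 0 > 1" for m
    using that a0pos by (simp add: pos_divide_le_eq mult_le_cancel_left1)
  \<comment> \<open>With modulus 1 both alternatives of \<open>inf_m\<close>, and both of
    \<open>one_m\<close>, read \<open>1 + ?a m\<close>.\<close>
  have parta: "norm_min (frobenius_companion p) \<le> norm_min A" if "?a 0 = 1"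
  proof (rule F)
    show "?a 0 \<le> norm_min A" using that inf_1 one_a0 by (simp add: norm_min_def)
    show "1 + ?a m \<le> norm_min A" if "1 \<le> m" "m < n" for m
      using inf_m[OF that] one_m[OF that] \<open>?a 0 = 1\<close> by (auto simp: norm_min_def)
  qed
  \<comment> \<open>Either alternative of \<open>inf_m\<close> is at least
    \<open>1 + ?a m / ?a 0\<close>; for the first this uses \<open>large\<close> and
    \<open>?a 0 > 1\<close>.\<close>
  have partb: "norm_inf (W_mat p) \<le> norm_inf A" if a: "?a 0 > 1"
  proof (rule norm_inf_W_mat_le[OF deg _ inf_1 inf_first])
    show "cmod (coeff p m / coeff p 0) + 1 \<le> norm_inf A" if "1 \<le> m" "m < n - 1" for m
      using inf_m[of m] large[OF a, of m] a that unfolding norm_divide by linarith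
  qed (use n3 in simp)
  \<comment> \<open>The entry \<open>- coeff p (n - 1)\<close> is always in the corner of
    \<open>A\<close>, and here it dominates every other \<open>coeff p m\<close>.\<close>
  have partc: "norm_min (frobenius_companion p) \<le> norm_min A" if a: "?a 0 > 1" "?a (n - 1) = M"
  proof (rule F)
    show "?a 0 \<le> norm_min A"
      using inf_first one_a0 norm_ge_zero[of "coeff p (n - 1)"]
      by (simp add: norm_min_def del: norm_ge_zero)
    show "1 + ?a m \<le> norm_min A" if "1 \<le> m" "m < n" for m
    proof -
      have "?a m \<le> ?a (n - 1)" unfolding a(2) M using that by (intro Max_ge) auto
      then show ?thesis using inf_first one_first a by (simp add: norm_min_def)
    qed
  qed
  \<comment> \<open>Division by \<open>?a 0 < 1\<close> only enlarges, so the weak case is the first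
    alternative of \<open>inf_m\<close>: there the partner of \<open>coeff p m\<close> is below 1,
    which costs the extra 1.\<close>
  have partd: "norm_min (frobenius_companion p) \<le> 1 + norm_inf A"
    "norm_min (frobenius_companion p) \<le> norm_one A" if a: "?a 0 < 1"
  proof -
    show "norm_min (frobenius_companion p) \<le> 1 + norm_inf A"
    proof (rule F)
      show "?a 0 \<le> 1 + norm_inf A" using a inf_1 by linarith
      show "1 + ?a m \<le> 1 + norm_inf A" if "1 \<le> m" "m < n" for m
        using inf_m[OF that] small[of m] a a0pos by linarith
    qed
    show "norm_min (frobenius_companion p) \<le> norm_one A"
    proof (rule F)
      show "?a 0 \<le> norm_one A" by (rule one_a0)
      show "1 + ?a m \<le> norm_one A" if "1 \<le> m" "m < n" for m
        using one_m[OF that] small[of m] a by linarith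
    qed
  qed
  show ?thesis
    \<comment> \<open>The factor 2 comes from \<open>1 + norm_inf A \<le> 2 * norm_inf A\<close>, by
      \<open>inf_1\<close>.\<close>
    using parta partb partc partd inf_1 by (intro conjI impI) (blast | fastforce)+
qed

end
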